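(* Let $A,C\in\mathbb{R}^{m\times n}$ and $b,d\in\mathbb{R}^m$ be such that $A^TC$ is positive semi-definite and the system $Ax-b\ge0$, $Cx-d\ge0$, $(Ax-b)^T(Cx-d)=0$ has a solution. Let $\nu,\sigma,\rho>0$ and let $\mu$ be a fixed multiplier. Let $\mathcal{F}=\{x\in\mathbb{R}^n:Ax-b\ge0,\ Cx-d\ge0\}$ and consider the DC program $$\min_{x\in\mathcal{F}}\ \Psi(x):=f_1(x)-f_2(x),$$ where $f_1(x)=\sum_{i=1}^n\frac{|x_i|}{\nu}+\varphi(x,\mu,\rho)$ and $f_2(x)=\sum_{i=1}^n\max\{\theta_1(x_i),\theta_2(x_i),\theta_3(x_i)\}$. Suppose that $x^0\in\mathcal{F}$ and that $L(x^0):=\{x\in\mathcal{F}:\Psi(x)\le\Psi(x^0)\}$ is bounded. Then the sequence $\{x^{j}\}$ generated by the DC algorithm (described in the context) with starting point $x^0$ is bounded, and any accumulation point of it is a lifted stationary point of this DC program.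
   Context: Inequalities between vectors are componentwise, $[t]_+=\max\{t,0\}$, and $\boldsymbol e_i$ is the $i$th standard basis vector of $\mathbb{R}^n$. Positive semi-definiteness of $A^TC$ (not necessarily symmetric) means $z^TA^TCz\ge0$ for all $z\in\mathbb{R}^n$. $\varphi(x,\mu,\rho)=\frac{1}{2\rho}\big([\mu+\rho h_\sigma(x)]_+^2-\mu^2\big)$ with $h_\sigma(x)=(Ax-b)^T(Cx-d)-\sigma$ and $\mu\in\mathbb{R}$. $\theta_1(t)=0$, $\theta_2(t)=t/\nu-1$, $\theta_3(t)=-t/\nu-1$; $\mathcal{D}(t)=\{i\in\{1,2,3\}:\theta_i(t)=\max\{\theta_1(t),\theta_2(t),\theta_3(t)\}\}$. DC algorithm (Algorithm 3): starting from $x^0\in\mathcal{F}$, for $j=0,1,2,\dots$ define indices $\delta_i^{j}$, $i=1,\dots,n$, by $\delta_i^{j}=1$ if $|x_i^{j}|<\nu$, $\delta_i^{j}=2$ if $x_i^{j}\ge\nu$, $\delta_i^{j}=3$ if $x_i^{j}\le-\nu$, and set $$x^{j+1}=\operatorname*{argmin}_{y\in\mathcal{F}}\ f_1(y)-\sum_{i=1}^n\theta_{\delta_i^{j}}(x_i^{j})-\sum_{i=1}^n\theta_{\delta_i^{j}}'(x_i^{j})(y_i-x_i^{j})+\frac12\|y-x^{j}\|^2$$ (the objective is strongly convex under the stated assumptions, so the minimizer is unique). A point $\bar x\in\mathcal{F}$ is a lifted stationary point of the DC program if there exist indices $\delta_i\in\mathcal{D}(\bar x_i)$, $i=1,\dots,n$,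 such that $$0\in\partial f_1(\bar x)-\sum_{i=1}^n\theta_{\delta_i}'(\bar x_i)\boldsymbol e_i+\mathcal{N}_{\mathcal{F}}(\bar x),$$ where $\partial f_1$ is the convex subdifferential and $\mathcal{N}_{\mathcal{F}}$ the normal cone of the convex set $\mathcal{F}$. *)

theory Defs
  imports "HOL-Analysis.Analysis"
begin

definition pos_semidef :: "real^'n^'n \<Rightarrow> bool" where
  "pos_semidef M \<longleftrightarrow> (\<forall>z. z \<bullet> (M *v z) \<ge> 0)"

(* The order on real^'m is the componentwise one. *)
definition feasible_set ::
    "real^'n^'m \<Rightarrow> real^'m \<Rightarrow> real^'n^'m \<Rightarrow> real^'m \<Rightarrow> (real^'n) set" where
  "feasible_set A b C d = {x. A *v x - b \<ge> 0 \<and> C *v x - d \<ge> 0}"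

definition h_relaxed ::
    "real^'n^'m \<Rightarrow> real^'m \<Rightarrow> real^'n^'m \<Rightarrow> real^'m \<Rightarrow> real \<Rightarrow> real^'n \<Rightarrow> real" where
  "h_relaxed A b C d \<sigma> x = (A *v x - b) \<bullet> (C *v x - d) - \<sigma>"

definition aug_term ::
    "real^'n^'m \<Rightarrow> real^'m \<Rightarrow> real^'n^'m \<Rightarrow> real^'m \<Rightarrow> real \<Rightarrow> real^'n \<Rightarrow> real \<Rightarrow> real \<Rightarrow> real" where
  "aug_term A b C d \<sigma> x \<mu> \<rho> =
     1 / (2 * \<rho>) * ((max (\<mu> + \<rho> * h_relaxed A b C d \<sigma> x) 0)\<^sup>2 - \<mu>\<^sup>2)"

(* Only the indices 1, 2, 3 are meaningful. *)
definition theta :: "real \<Rightarrow> nat \<Rightarrow> real \<Rightarrow> real" where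
  "theta \<nu> k t = (if k = 1 then 0 else if k = 2 then t / \<nu> - 1 else - t / \<nu> - 1)"

definition theta_max :: "real \<Rightarrow> real \<Rightarrow> real" where
  "theta_max \<nu> t = max (theta \<nu> 1 t) (max (theta \<nu> 2 t) (theta \<nu> 3 t))"

definition active_set :: "real \<Rightarrow> real \<Rightarrow> nat set" where
  "active_set \<nu> t = {k \<in> {1, 2, 3}. theta \<nu> k t = theta_max \<nu> t}"

definition dc_f1 ::
    "real^'n^'m \<Rightarrow> real^'m \<Rightarrow> real^'n^'m \<Rightarrow> real^'m \<Rightarrow> real \<Rightarrow> real \<Rightarrow> real \<Rightarrow> real \<Rightarrow> real^'n \<Rightarrow> real" where
  "dc_f1 A b C d \<nu> \<sigma> \<rho> \<mu> x = (\<Sum>i\<in>UNIV. \<bar>x $ i\<bar> / \<nu>) + aug_term A b C d \<sigma> x \<mu> \<rho>"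

definition dc_f2 :: "real \<Rightarrow> real^'n \<Rightarrow> real" where
  "dc_f2 \<nu> x = (\<Sum>i\<in>UNIV. theta_max \<nu> (x $ i))"

definition dc_obj ::
    "real^'n^'m \<Rightarrow> real^'m \<Rightarrow> real^'n^'m \<Rightarrow> real^'m \<Rightarrow> real \<Rightarrow> real \<Rightarrow> real \<Rightarrow> real \<Rightarrow> real^'n \<Rightarrow> real" where
  "dc_obj A b C d \<nu> \<sigma> \<rho> \<mu> x = dc_f1 A b C d \<nu> \<sigma> \<rho> \<mu> x - dc_f2 \<nu> x"

definition dc_index :: "real \<Rightarrow> real \<Rightarrow> nat" where
  "dc_index \<nu> t = (if \<bar>t\<bar> < \<nu> then 1 else if t \<ge> \<nu> then 2 else 3)"

definition dc_model ::
    "real^'n^'m \<Rightarrow> real^'m \<Rightarrow> real^'n^'m \<Rightarrow> real^'m \<Rightarrow> real \<Rightarrow> real \<Rightarrow> real \<Rightarrow> real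
      \<Rightarrow> real^'n \<Rightarrow> real^'n \<Rightarrow> real" where
  "dc_model A b C d \<nu> \<sigma> \<rho> \<mu> x y =
     dc_f1 A b C d \<nu> \<sigma> \<rho> \<mu> y
     - (\<Sum>i\<in>UNIV. theta \<nu> (dc_index \<nu> (x $ i)) (x $ i))
     - (\<Sum>i\<in>UNIV. deriv (theta \<nu> (dc_index \<nu> (x $ i))) (x $ i) * (y $ i - x $ i))
     + 1 / 2 * (norm (y - x))\<^sup>2"

(* THE is used because the minimizer of the strongly convex subproblem exists and is unique
   (for \<nu>, \<sigma>, \<rho> > 0, transpose A ** C positive semi-definite and a nonempty feasible set). *)
primrec dc_seq ::
    "real^'n^'m \<Rightarrow> real^'m \<Rightarrow> real^'n^'m \<Rightarrow> real^'m \<Rightarrow> real \<Rightarrow> real \<Rightarrow> real \<Rightarrow> real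
      \<Rightarrow> real^'n \<Rightarrow> nat \<Rightarrow> real^'n" where
  "dc_seq A b C d \<nu> \<sigma> \<rho> \<mu> x0 0 = x0"
| "dc_seq A b C d \<nu> \<sigma> \<rho> \<mu> x0 (Suc j) =
     (THE y. is_arg_min (dc_model A b C d \<nu> \<sigma> \<rho> \<mu> (dc_seq A b C d \<nu> \<sigma> \<rho> \<mu> x0 j))
               (\<lambda>y. y \<in> feasible_set A b C d) y)"

definition subdifferential :: "('a::real_inner \<Rightarrow> real) \<Rightarrow> 'a \<Rightarrow> 'a set" where
  "subdifferential f x = {g. \<forall>y. f y \<ge> f x + g \<bullet> (y - x)}"

definition normal_cone :: "'a::real_inner set \<Rightarrow> 'a \<Rightarrow> 'a set" where
  "normal_cone S x = (if x \<in> S then {v. \<forall>y\<in>S. v \<bullet> (y - x) \<le> 0} else {})"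

definition lifted_stationary ::
    "real^'n^'m \<Rightarrow> real^'m \<Rightarrow> real^'n^'m \<Rightarrow> real^'m \<Rightarrow> real \<Rightarrow> real \<Rightarrow> real \<Rightarrow> real
      \<Rightarrow> real^'n \<Rightarrow> bool" where
  "lifted_stationary A b C d \<nu> \<sigma> \<rho> \<mu> x \<longleftrightarrow>
     x \<in> feasible_set A b C d \<and>
     (\<exists>\<delta> :: 'n \<Rightarrow> nat. (\<forall>i. \<delta> i \<in> active_set \<nu> (x $ i)) \<and>
        0 \<in> {g - (\<Sum>i\<in>UNIV. deriv (theta \<nu> (\<delta> i)) (x $ i) *\<^sub>R axis i 1) + v | g v.
               g \<in> subdifferential (dc_f1 A b C d \<nu> \<sigma> \<rho> \<mu>) x \<and>
               v \<in> normal_cone (feasible_set A b C d) x})"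

definition accumulation_point :: "(nat \<Rightarrow> 'a::topological_space) \<Rightarrow> 'a \<Rightarrow> bool" where
  "accumulation_point X l \<longleftrightarrow> (\<exists>r :: nat \<Rightarrow> nat. strict_mono r \<and> (X \<circ> r) \<longlonglongrightarrow> l)"

end

theory Submission
  imports Defs
begin

text \<open>
  The pieces \<open>\<theta>\<^sub>1, \<theta>\<^sub>2, \<theta>\<^sub>3\<close> are affine, so the linearization of each of them at any point is
  the piece itself. The subproblem at \<open>x\<^sup>j\<close> is therefore a proximal step: it minimizes
  \<open>g\<^sub>\<delta>(y) + \<parallel>y - x\<^sup>j\<parallel>\<^sup>2 / 2\<close> over the feasible set, where \<open>g\<^sub>\<delta>(y) = f\<^sub>1(y) - (\<Sum>i. \<theta>\<^sub>\<delta>\<^sub>i(y\<^sub>i))\<close> is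
  convex and depends on \<open>x\<^sup>j\<close> only through the choice \<open>\<delta>\<close> of pieces (\<open>dc_model_eq_prox\<close>).
  Convexity of \<open>f\<^sub>1\<close> on the whole space comes from positive semi-definiteness of \<open>A\<^sup>TC\<close>, which
  makes \<open>h\<^sub>\<sigma>\<close> convex.

  Since \<open>g\<^sub>\<delta> \<ge> \<Psi>\<close> everywhere, with equality at \<open>x\<^sup>j\<close> for the pieces chosen there, comparing the
  minimizer with \<open>x\<^sup>j\<close> gives the descent estimate
  \<open>\<Psi>(x\<^sup>j\<^sup>+\<^sup>1) + \<parallel>x\<^sup>j\<^sup>+\<^sup>1 - x\<^sup>j\<parallel>\<^sup>2 / 2 \<le> \<Psi>(x\<^sup>j)\<close> (\<open>dc_seq_descent\<close>). Hence the iterates stay in the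
  bounded level set of \<open>x\<^sup>0\<close>; and because \<open>\<Psi>\<close> is bounded below, consecutive iterates approach
  each other (\<open>dc_seq_steps_vanish\<close>).

  For stationarity of an accumulation point, there are only finitely many choices of pieces, so a
  further subsequence uses a single \<open>\<delta>\<close>. Optimality of each step gives, without the quadratic term,
  the variational inequality
  \<open>g\<^sub>\<delta>(x\<^sup>j\<^sup>+\<^sup>1) + (x\<^sup>j - x\<^sup>j\<^sup>+\<^sup>1) \<bullet> (y - x\<^sup>j\<^sup>+\<^sup>1) \<le> g\<^sub>\<delta>(y)\<close> (\<open>prox_inequality\<close>). In the limit the inner
  product disappears: the accumulation point minimizes the convex function \<open>g\<^sub>\<delta>\<close> over the feasible
  set, and \<open>\<delta>\<close> is active there by continuity. A separation argument turns this minimality into the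
  inclusion with subgradient and normal vector (\<open>minimizer_subgradient_normal\<close>).
\<close>

section \<open>Proximal steps on convex functions\<close>

text \<open>
  Moving from the minimizer \<open>p\<close> towards \<open>y\<close> by a fraction \<open>u\<close> changes the convex part by at most
  \<open>u (f y - f p)\<close>, and the quadratic term to first order by \<open>u (p - x) \<bullet> (y - p)\<close>. The total change is
  nonnegative, and the error is of order \<open>u\<^sup>2\<close>.
\<close>

lemma prox_inequality:
  fixes f :: "'a::real_inner \<Rightarrow> real"
  assumes f: "convex_on S f" and p: "p \<in> S" and y: "y \<in> S"
    and min: "\<And>z. z \<in> S \<Longrightarrow> f p + (norm (p - x))\<^sup>2 / 2 \<le> f z + (norm (z - x))\<^sup>2 / 2"
  shows "f p + (x - p) \<bullet> (y - p) \<le> f y"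
proof -
  have S: "convex S" using f by (rule convex_on_imp_convex)
  \<comment> \<open>Divide the optimality condition along the segment by \<open>u\<close>; then let \<open>u\<close> tend to \<open>0\<close>.\<close>
  have *: "f p + (x - p) \<bullet> (y - p) - f y \<le> u * ((norm (y - p))\<^sup>2 / 2)" if u: "0 < u" "u < 1" for u
  proof -
    define z where "z = (1 - u) *\<^sub>R p + u *\<^sub>R y"
    have "z \<in> S" unfolding z_def using S p y u by (intro convexD_alt) auto
    have "f z \<le> (1 - u) * f p + u * f y"
      unfolding z_def using f p y u by (intro convex_onD) auto
    moreover have "(norm (z - x))\<^sup>2 =
        (norm (p - x))\<^sup>2 + 2 * u * ((p - x) \<bullet> (y - p)) + u\<^sup>2 * (norm (y - p))\<^sup>2"
    proof -
      have "z - x = (p - x) + u *\<^sub>R (y - p)" by (simp add: z_def algebra_simps)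
      then show ?thesis
        by (simp only: power2_norm_eq_inner)
          (simp add: inner_add_left inner_add_right inner_commute power2_eq_square algebra_simps)
    qed
    moreover note min[OF \<open>z \<in> S\<close>]
    moreover have "(x - p) \<bullet> (y - p) = - ((p - x) \<bullet> (y - p))"
      by (simp add: inner_diff_left)
    ultimately have "u * (f p + (x - p) \<bullet> (y - p) - f y) \<le> u * (u * ((norm (y - p))\<^sup>2 / 2))"
      by (simp add: algebra_simps power2_eq_square)
    then show ?thesis using u by simp
  qed
  have "((\<lambda>u. u * ((norm (y - p))\<^sup>2 / 2)) \<longlongrightarrow> 0 * ((norm (y - p))\<^sup>2 / 2)) (at_right 0)"
    by (intro tendsto_intros)
  moreover have "\<forall>\<^sub>F u::real in at_right 0. f p + (x - p) \<bullet> (y - p) - f y \<le> u * ((norm (y - p))\<^sup>2 / 2)"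
    by (rule eventually_mono[OF eventually_at_right_real[of 0 1]]) (use * in auto)
  ultimately have "f p + (x - p) \<bullet> (y - p) - f y \<le> 0 * ((norm (y - p))\<^sup>2 / 2)"
    by (intro tendsto_lowerbound) auto
  then show ?thesis by simp
qed

text \<open>
  Adding the variational inequalities of the two minimizers, each tested at the other one, leaves
  \<open>\<parallel>q - p\<parallel>\<^sup>2 \<le> 0\<close>.
\<close>

lemma prox_unique:
  fixes f :: "'a::real_inner \<Rightarrow> real"
  assumes f: "convex_on S f" and p: "p \<in> S" and q: "q \<in> S"
    and min_p: "\<And>z. z \<in> S \<Longrightarrow> f p + (norm (p - x))\<^sup>2 / 2 \<le> f z + (norm (z - x))\<^sup>2 / 2"
    and min_q: "\<And>z. z \<in> S \<Longrightarrow> f q + (norm (q - x))\<^sup>2 / 2 \<le> f z + (norm (z - x))\<^sup>2 / 2"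
  shows "p = q"
proof -
  have "f p + (x - p) \<bullet> (q - p) \<le> f q" by (rule prox_inequality[OF f p q min_p])
  moreover have "f q + (x - q) \<bullet> (p - q) \<le> f p" by (rule prox_inequality[OF f q p min_q])
  ultimately have "(x - p) \<bullet> (q - p) + (x - q) \<bullet> (p - q) \<le> 0" by linarith
  moreover have "(x - p) \<bullet> (q - p) + (x - q) \<bullet> (p - q) = (q - p) \<bullet> (q - p)"
    by (simp add: inner_diff_left inner_diff_right inner_commute)
  ultimately show ?thesis
    using inner_ge_zero[of "q - p"] by (metis antisym inner_eq_zero_iff eq_iff_diff_eq_0)
qed

text \<open>
  A lower bound on \<open>f\<close> makes the sum with the quadratic coercive, so minimization may be restricted
  to a compact ball.
\<close>

lemma prox_exists:
  fixes f :: "'a::euclidean_space \<Rightarrow> real"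
  assumes cont: "continuous_on S f" and S: "closed S" "S \<noteq> {}" and lb: "\<And>y. y \<in> S \<Longrightarrow> c \<le> f y"
  obtains p where "p \<in> S"
    and "\<And>z. z \<in> S \<Longrightarrow> f p + (norm (p - x))\<^sup>2 / 2 \<le> f z + (norm (z - x))\<^sup>2 / 2"
proof -
  define g where "g z = f z + (norm (z - x))\<^sup>2 / 2" for z
  obtain w where w: "w \<in> S" using S by auto
  have gcont: "continuous_on S g"
    unfolding g_def by (intro continuous_intros cont) auto
  define r where "r = sqrt (2 * (g w - c))"
  \<comment> \<open>Every point of \<open>S\<close> with value at most \<open>g w\<close> lies within distance \<open>r\<close> of the centre.\<close>
  have near: "z \<in> cball x r" if "z \<in> S" "g z \<le> g w" for z
  proof -
    have "(norm (z - x))\<^sup>2 \<le> 2 * (g w - c)" using that lb[of z] by (simp add: g_def)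
    then show ?thesis unfolding r_def
      by (metis dist_commute dist_norm mem_cball real_le_rsqrt)
  qed
  have "compact (S \<inter> cball x r)" using S by (simp add: closed_Int_compact)
  moreover have "w \<in> S \<inter> cball x r" using w near by auto
  moreover have "continuous_on (S \<inter> cball x r) g"
    using gcont by (rule continuous_on_subset) auto
  ultimately obtain p where p: "p \<in> S \<inter> cball x r" "\<And>z. z \<in> S \<inter> cball x r \<Longrightarrow> g p \<le> g z"
    using continuous_attains_inf[of "S \<inter> cball x r" g] by blast
  have "g p \<le> g z" if "z \<in> S" for z
    using p(2)[of z] p(2)[of w] near[of z] that \<open>w \<in> S \<inter> cball x r\<close> by (cases "g z \<le> g w") auto
  then show thesis using that[of p] p(1) by (auto simp: g_def)
qed

section \<open>First-order optimality on a convex set\<close>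

text \<open>
  The special case of the Moreau--Rockafellar sum rule needed for lifted stationarity. In the product
  space, the strict epigraph of \<open>f - f p\<close> and the set \<open>S \<times> {..0}\<close> are disjoint and convex. A
  hyperplane separating them is not vertical, because \<open>f\<close> is finite everywhere; its normal vector
  \<open>(a, s)\<close>, scaled to \<open>s = 1\<close>, has the wanted \<open>v\<close> as first component.
\<close>

lemma minimizer_subgradient_normal:
  fixes f :: "'a::euclidean_space \<Rightarrow> real"
  assumes f: "convex_on UNIV f" and S: "convex S" and p: "p \<in> S"
    and min: "\<And>y. y \<in> S \<Longrightarrow> f p \<le> f y"
  obtains v where "v \<in> normal_cone S p" and "- v \<in> subdifferential f p"
proof -
  define E where "E = {(y, t). f y - f p < t}"
  define T where "T = S \<times> {..0::real}"
  have convE: "convex E"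
  proof (rule convexI)
    fix a b and u v :: real
    assume ab: "a \<in> E" "b \<in> E" and uv: "0 \<le> u" "0 \<le> v" "u + v = 1"
    obtain y s z t where eq: "a = (y, s)" "b = (z, t)" by (cases a, cases b) auto
    have lt: "f y - f p < s" "f z - f p < t" using ab by (auto simp: E_def eq)
    have "f (u *\<^sub>R y + v *\<^sub>R z) \<le> u * f y + v * f z"
      using f uv by (auto simp: convex_on_def)
    moreover have "u * (f y - f p) + v * (f z - f p) < u * s + v * t"
    proof (cases "u = 0")
      case True then show ?thesis using lt uv by simp
    next
      case False
      then have "u * (f y - f p) < u * s" using lt uv by simp
      moreover have "v * (f z - f p) \<le> v * t" using lt uv by (intro mult_left_mono) auto
      ultimately show ?thesis by linarith
    qed
    moreover have "u * (f y - f p) + v * (f z - f p) = u * f y + v * f z - f p"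
    proof -
      have v: "v = 1 - u" using uv(3) by simp
      show ?thesis unfolding v by (simp add: algebra_simps)
    qed
    ultimately show "u *\<^sub>R a + v *\<^sub>R b \<in> E" by (auto simp: E_def eq)
  qed
  have convT: "convex T" unfolding T_def by (intro convex_Times S convex_real_interval)
  have disj: "T \<inter> E = {}" using min by (force simp: T_def E_def)
  have ne: "T \<noteq> {}" "E \<noteq> {}"
    using p by (auto simp: T_def E_def intro: exI[of _ "f p - f p + 1"] lt_ex gt_ex)
  obtain c \<beta> where c: "c \<noteq> 0" "\<And>x. x \<in> T \<Longrightarrow> c \<bullet> x \<le> \<beta>" "\<And>x. x \<in> E \<Longrightarrow> \<beta> \<le> c \<bullet> x"
    using separating_hyperplane_sets[OF convT convE ne disj] by blast
  obtain a s where as: "c = (a, s)" by (cases c)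
  have T: "a \<bullet> z \<le> \<beta>" if "z \<in> S" for z
    using c(2)[of "(z, 0)"] that by (simp add: T_def as)
  have E: "\<beta> \<le> a \<bullet> y + s * t" if "f y - f p < t" for y t
    using c(3)[of "(y, t)"] that by (simp add: E_def as)
  have s0: "s \<ge> 0"
    using T[OF p] E[of p 1] by simp
  have "s \<noteq> 0"
  proof
    assume "s = 0"
    \<comment> \<open>A vertical hyperplane would bound the linear form \<open>a\<close> from below on the whole space.\<close>
    then have "a \<noteq> 0" using c(1) as by (auto simp: zero_prod_def)
    have lb: "\<beta> \<le> a \<bullet> y" for y using E[of y "f y - f p + 1"] \<open>s = 0\<close> by simp
    have "a \<bullet> a > 0" using \<open>a \<noteq> 0\<close> by simp
    have "\<beta> \<le> a \<bullet> (((\<beta> - 1) / (a \<bullet> a)) *\<^sub>R a)" by (rule lb)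
    also have "\<dots> = \<beta> - 1" using \<open>a \<bullet> a > 0\<close> by simp
    finally show False by simp
  qed
  with s0 have s: "s > 0" by simp
  \<comment> \<open>The separation inequality extends from the strict epigraph to the graph.\<close>
  have E': "\<beta> \<le> a \<bullet> y + s * (f y - f p)" for y
  proof (rule field_le_epsilon)
    fix e :: real assume "e > 0"
    then have "\<beta> \<le> a \<bullet> y + s * (f y - f p + e / s)" using s by (intro E) simp
    then show "\<beta> \<le> a \<bullet> y + s * (f y - f p) + e" using s by (simp add: distrib_left)
  qed
  have "(a /\<^sub>R s) \<in> normal_cone S p"
  proof -
    have "a \<bullet> (y - p) \<le> 0" if "y \<in> S" for y
      using T[OF that] E'[of p] by (simp add: inner_diff_right)
    then show ?thesis using p s by (auto simp: normal_cone_def divide_simps mult_le_0_iff)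
  qed
  moreover have "- (a /\<^sub>R s) \<in> subdifferential f p"
  proof -
    have "f p + - (a /\<^sub>R s) \<bullet> (y - p) \<le> f y" for y
    proof -
      have "- (a \<bullet> (y - p)) \<le> s * (f y - f p)"
        using T[OF p] E'[of y] by (simp add: inner_diff_right)
      then have "- (a \<bullet> (y - p)) / s \<le> f y - f p" using s by (subst pos_divide_le_eq) (simp_all add: mult.commute)
      then show ?thesis by (simp add: divide_inverse mult.commute)
    qed
    then show ?thesis by (simp add: subdifferential_def)
  qed
  ultimately show thesis by (rule that)
qed

section \<open>The convex part of the objective and the feasible set\<close>

text \<open>
  Along a segment, the bilinear term \<open>(A x - b) \<bullet> (C x - d)\<close> falls below linear interpolation by
  \<open>t (1 - t)\<close> times the quadratic form of \<open>A\<^sup>TC\<close> at \<open>x - y\<close>.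
\<close>

lemma convex_on_h_relaxed:
  fixes A C :: "real^'n^'m"
  assumes "pos_semidef (transpose A ** C)"
  shows "convex_on UNIV (h_relaxed A b C d \<sigma>)"
proof (rule convex_onI)
  fix t :: real and x y :: "real^'n" assume t: "0 < t" "t < 1"
  define z where "z = (1 - t) *\<^sub>R x + t *\<^sub>R y"
  have "0 \<le> (x - y) \<bullet> ((transpose A ** C) *v (x - y))"
    using assms by (simp add: pos_semidef_def)
  also have "\<dots> = (A *v (x - y)) \<bullet> (C *v (x - y))"
    by (metis dot_lmul_matrix matrix_vector_mul_assoc transpose_matrix_vector transpose_transpose inner_commute)
  finally have psd: "0 \<le> (A *v (x - y)) \<bullet> (C *v (x - y))" .
  have "A *v z - b = (1 - t) *\<^sub>R (A *v x - b) + t *\<^sub>R (A *v y - b)"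
    unfolding z_def matrix_vector_right_distrib matrix_vector_mult_scaleR by (simp add: algebra_simps)
  moreover have "C *v z - d = (1 - t) *\<^sub>R (C *v x - d) + t *\<^sub>R (C *v y - d)"
    unfolding z_def matrix_vector_right_distrib matrix_vector_mult_scaleR by (simp add: algebra_simps)
  moreover have "A *v (x - y) = (A *v x - b) - (A *v y - b)" "C *v (x - y) = (C *v x - d) - (C *v y - d)"
    by (simp_all add: matrix_vector_mult_diff_distrib)
  moreover have "((1 - t) *\<^sub>R p + t *\<^sub>R q) \<bullet> ((1 - t) *\<^sub>R p' + t *\<^sub>R q') =
      (1 - t) * (p \<bullet> p') + t * (q \<bullet> q') - t * (1 - t) * ((p - q) \<bullet> (p' - q'))"
    for p q p' q' :: "real^'m"
    by (simp add: inner_add_left inner_add_right inner_diff_left inner_diff_right algebra_simps)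
  ultimately have "h_relaxed A b C d \<sigma> z = (1 - t) * h_relaxed A b C d \<sigma> x + t * h_relaxed A b C d \<sigma> y
      - t * (1 - t) * ((A *v (x - y)) \<bullet> (C *v (x - y)))"
    unfolding h_relaxed_def by (simp only:) (simp add: algebra_simps)
  moreover have "0 \<le> t * (1 - t) * ((A *v (x - y)) \<bullet> (C *v (x - y)))" using psd t by simp
  ultimately show "h_relaxed A b C d \<sigma> ((1 - t) *\<^sub>R x + t *\<^sub>R y)
      \<le> (1 - t) * h_relaxed A b C d \<sigma> x + t * h_relaxed A b C d \<sigma> y"
    by (simp add: z_def)
qed simp

lemma convex_on_pos_part_square:
  assumes h: "convex_on S h"
  shows "convex_on S (\<lambda>x. (max (h x) 0)\<^sup>2)"
proof (rule convex_onI)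
  show "convex S" using h by (rule convex_on_imp_convex)
  fix t :: real and x y assume t: "0 < t" "t < 1" and xy: "x \<in> S" "y \<in> S"
  define p q where "p = max (h x) 0" and "q = max (h y) 0"
  have "h ((1 - t) *\<^sub>R x + t *\<^sub>R y) \<le> (1 - t) * h x + t * h y"
    using h t xy by (intro convex_onD) auto
  also have "\<dots> \<le> (1 - t) * p + t * q"
    using t by (intro add_mono mult_left_mono) (auto simp: p_def q_def)
  finally have "max (h ((1 - t) *\<^sub>R x + t *\<^sub>R y)) 0 \<le> (1 - t) * p + t * q"
    using t by (auto simp: p_def q_def)
  then have "(max (h ((1 - t) *\<^sub>R x + t *\<^sub>R y)) 0)\<^sup>2 \<le> ((1 - t) * p + t * q)\<^sup>2"
    by (intro power_mono) auto
  also have "\<dots> = (1 - t) * p\<^sup>2 + t * q\<^sup>2 - t * (1 - t) * (p - q)\<^sup>2"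
    by (simp add: power2_eq_square algebra_simps)
  also have "\<dots> \<le> (1 - t) * p\<^sup>2 + t * q\<^sup>2" using t by simp
  finally show "(max (h ((1 - t) *\<^sub>R x + t *\<^sub>R y)) 0)\<^sup>2
      \<le> (1 - t) * (max (h x) 0)\<^sup>2 + t * (max (h y) 0)\<^sup>2"
    by (simp add: p_def q_def)
qed

lemma convex_on_dc_f1:
  fixes A C :: "real^'n^'m"
  assumes psd: "pos_semidef (transpose A ** C)" and "\<nu> > 0" "\<rho> > 0"
  shows "convex_on UNIV (dc_f1 A b C d \<nu> \<sigma> \<rho> \<mu>)"
proof -
  have "convex_on UNIV (\<lambda>x. \<mu> + \<rho> * h_relaxed A b C d \<sigma> x)"
    using \<open>\<rho> > 0\<close> by (intro convex_on_add convex_on_cmul convex_on_h_relaxed psd) (auto simp: convex_on_const)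
  from convex_on_cmul[OF _ convex_on_add[OF convex_on_pos_part_square[OF this] convex_on_const[THEN iffD2, OF convex_UNIV, of "- \<mu>\<^sup>2"]], of "1 / (2 * \<rho>)"]
  have aug: "convex_on UNIV (\<lambda>x. aug_term A b C d \<sigma> x \<mu> \<rho>)"
    using \<open>\<rho> > 0\<close> by (simp add: aug_term_def)
  have "convex_on UNIV (\<lambda>x::real^'n. \<bar>x $ i\<bar> / \<nu>)" for i
  proof (rule convex_onI)
    fix t :: real and x y :: "real^'n" assume t: "0 < t" "t < 1"
    have "\<bar>((1 - t) *\<^sub>R x + t *\<^sub>R y) $ i\<bar> \<le> \<bar>(1 - t) * x $ i\<bar> + \<bar>t * y $ i\<bar>"
      by (simp add: abs_triangle_ineq)
    also have "\<dots> = (1 - t) * \<bar>x $ i\<bar> + t * \<bar>y $ i\<bar>" using t by (simp add: abs_mult)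
    finally have "\<bar>((1 - t) *\<^sub>R x + t *\<^sub>R y) $ i\<bar> / \<nu> \<le> ((1 - t) * \<bar>x $ i\<bar> + t * \<bar>y $ i\<bar>) / \<nu>"
      using \<open>\<nu> > 0\<close> by (intro divide_right_mono) auto
    then show "\<bar>((1 - t) *\<^sub>R x + t *\<^sub>R y) $ i\<bar> / \<nu> \<le> (1 - t) * (\<bar>x $ i\<bar> / \<nu>) + t * (\<bar>y $ i\<bar> / \<nu>)"
      by (simp add: add_divide_distrib)
  qed simp
  then have "convex_on UNIV (\<lambda>x::real^'n. \<Sum>i\<in>UNIV. \<bar>x $ i\<bar> / \<nu>)"
  proof -
    assume *: "\<And>i. convex_on UNIV (\<lambda>x::real^'n. \<bar>x $ i\<bar> / \<nu>)"
    have "convex_on UNIV (\<lambda>x::real^'n. \<Sum>i\<in>I. \<bar>x $ i\<bar> / \<nu>)" for I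
      by (induction I rule: infinite_finite_induct) (auto simp: convex_on_const intro: convex_on_add *)
    then show ?thesis .
  qed
  from convex_on_add[OF this aug] show ?thesis by (simp add: dc_f1_def[abs_def])
qed

lemma continuous_on_dc_f1: "continuous_on S (dc_f1 A b C d \<nu> \<sigma> \<rho> \<mu>)"
  unfolding dc_f1_def[abs_def] aug_term_def h_relaxed_def divide_inverse
  by (intro continuous_intros matrix_vector_mult_linear_continuous_on)

lemma feasible_set_closed:
  fixes A C :: "real^'n^'m"
  shows "closed (feasible_set A b C d)"
proof -
  have *: "closed {x. 0 \<le> M *v x - c}" for M :: "real^'n^'m" and c
    unfolding less_eq_vec_def
    by (intro closed_Collect_all closed_Collect_le continuous_intros matrix_vector_mult_linear_continuous_on)
  show ?thesis unfolding feasible_set_def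
    using closed_Int[OF *[of A b] *[of C d]] by (simp add: Int_def)
qed

lemma feasible_set_convex:
  fixes A C :: "real^'n^'m"
  shows "convex (feasible_set A b C d)"
proof -
  have *: "0 \<le> M *v (u *\<^sub>R x + v *\<^sub>R y) - c"
    if "0 \<le> M *v x - c" "0 \<le> M *v y - c" "0 \<le> u" "0 \<le> v" "u + v = 1"
    for M :: "real^'n^'m" and c x y u v
  proof -
    have "M *v (u *\<^sub>R x + v *\<^sub>R y) - c = u *\<^sub>R (M *v x - c) + v *\<^sub>R (M *v y - c)"
    proof -
      have v: "v = 1 - u" using that(5) by simp
      show ?thesis unfolding v matrix_vector_right_distrib matrix_vector_mult_scaleR
        by (simp add: algebra_simps)
    qed
    then show ?thesis using that by (simp add: less_eq_vec_def)
  qed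
  show ?thesis unfolding feasible_set_def by (rule convexI) (blast intro: *)
qed

section \<open>The affine pieces and the convex majorant\<close>

text \<open>
  Exactness of the first-order expansion: linearizing the selected pieces in the subproblem loses
  nothing.
\<close>

lemma theta_affine: "theta \<nu> k y = theta \<nu> k x + deriv (theta \<nu> k) x * (y - x)"
proof -
  define c where "c = (if k = 1 then 0 else if k = 2 then 1 / \<nu> else - (1 / \<nu>))"
  have th: "theta \<nu> k = (\<lambda>t. theta \<nu> k 0 + c * t)"
    by (auto simp: theta_def c_def fun_eq_iff)
  have "((\<lambda>t. theta \<nu> k 0 + c * t) has_field_derivative c) (at x)"
    by (auto intro!: derivative_eq_intros)
  then have "deriv (theta \<nu> k) x = c" by (subst th) (rule DERIV_imp_deriv)
  moreover have "theta \<nu> k y = theta \<nu> k 0 + c * y" "theta \<nu> k x = theta \<nu> k 0 + c * x"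
    by (subst th, simp)+
  ultimately show ?thesis by (simp add: algebra_simps)
qed

lemma continuous_on_theta: "continuous_on S (theta \<nu> k)"
proof -
  have "continuous_on S (\<lambda>t. theta \<nu> k 0 + deriv (theta \<nu> k) 0 * (t - 0))"
    by (intro continuous_intros)
  then show ?thesis by (simp only: theta_affine[where x = 0, symmetric])
qed

lemma theta_le_max: "theta \<nu> k t \<le> theta_max \<nu> t"
  by (auto simp: theta_max_def theta_def)

lemma theta_max_le: "\<nu> > 0 \<Longrightarrow> theta_max \<nu> t \<le> \<bar>t\<bar> / \<nu>"
  unfolding theta_max_def theta_def
  using divide_right_mono[OF abs_ge_self[of t], of \<nu>] divide_right_mono[OF abs_ge_minus_self[of t], of \<nu>]
  by simp

lemma dc_index_range: "dc_index \<nu> t \<in> {1, 2, 3}"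
  by (simp add: dc_index_def)

text \<open>
  The rule that assigns a piece to each coordinate picks one attaining the maximum, also at the kinks
  \<open>\<bar>t\<bar> = \<nu>\<close>.
\<close>

lemma dc_index_active:
  assumes "\<nu> > 0"
  shows "dc_index \<nu> t \<in> active_set \<nu> t"
proof -
  have "\<bar>t\<bar> < \<nu> \<longleftrightarrow> - 1 < t / \<nu> \<and> t / \<nu> < 1" "\<nu> \<le> t \<longleftrightarrow> 1 \<le> t / \<nu>" using assms by (auto simp: abs_less_iff field_simps)
  then show ?thesis unfolding active_set_def theta_max_def theta_def dc_index_def
    by (auto simp: max_def)
qed

text \<open>
  A convex majorant of \<open>\<Psi>\<close>: in the subtracted maximum, the piece \<open>\<delta> i\<close> is used for coordinate \<open>i\<close>.
  It is indexed by \<open>\<delta>\<close> instead of a base point because iterates with equal \<open>\<delta>\<close> then share one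
  function, which makes the passage to the limit possible.
\<close>

definition linearized ::
    "real^'n^'m \<Rightarrow> real^'m \<Rightarrow> real^'n^'m \<Rightarrow> real^'m \<Rightarrow> real \<Rightarrow> real \<Rightarrow> real \<Rightarrow> real
      \<Rightarrow> ('n \<Rightarrow> nat) \<Rightarrow> real^'n \<Rightarrow> real" where
  "linearized A b C d \<nu> \<sigma> \<rho> \<mu> \<delta> y =
     dc_f1 A b C d \<nu> \<sigma> \<rho> \<mu> y - (\<Sum>i\<in>UNIV. theta \<nu> (\<delta> i) (y $ i))"

lemma dc_model_eq_prox:
  "dc_model A b C d \<nu> \<sigma> \<rho> \<mu> x y =
     linearized A b C d \<nu> \<sigma> \<rho> \<mu> (\<lambda>i. dc_index \<nu> (x $ i)) y + (norm (y - x))\<^sup>2 / 2"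
proof -
  have "(\<Sum>i\<in>UNIV. theta \<nu> (dc_index \<nu> (x $ i)) (y $ i)) =
      (\<Sum>i\<in>UNIV. theta \<nu> (dc_index \<nu> (x $ i)) (x $ i))
      + (\<Sum>i\<in>UNIV. deriv (theta \<nu> (dc_index \<nu> (x $ i))) (x $ i) * (y $ i - x $ i))"
    unfolding sum.distrib[symmetric] by (intro sum.cong refl theta_affine)
  then show ?thesis unfolding dc_model_def linearized_def by simp
qed

lemma dc_obj_le_linearized:
  "dc_obj A b C d \<nu> \<sigma> \<rho> \<mu> y \<le> linearized A b C d \<nu> \<sigma> \<rho> \<mu> \<delta> y"
  unfolding dc_obj_def linearized_def dc_f2_def
  by (intro diff_left_mono sum_mono theta_le_max)

lemma linearized_at_base:
  assumes "\<nu> > 0"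
  shows "linearized A b C d \<nu> \<sigma> \<rho> \<mu> (\<lambda>i. dc_index \<nu> (x $ i)) x = dc_obj A b C d \<nu> \<sigma> \<rho> \<mu> x"
proof -
  have "theta \<nu> (dc_index \<nu> t) t = theta_max \<nu> t" for t
    using dc_index_active[OF assms, of t] by (simp add: active_set_def)
  then show ?thesis by (simp add: linearized_def dc_obj_def dc_f2_def)
qed

text \<open>
  The \<open>\<ell>\<^sub>1\<close> term dominates the subtracted maximum, and the square in the augmented Lagrangian term is
  nonnegative.
\<close>

lemma dc_obj_lower_bound:
  assumes "\<nu> > 0" "\<rho> > 0"
  shows "- (\<mu>\<^sup>2 / (2 * \<rho>)) \<le> dc_obj A b C d \<nu> \<sigma> \<rho> \<mu> x"
proof -
  have "(\<Sum>i\<in>UNIV. theta_max \<nu> (x $ i)) \<le> (\<Sum>i\<in>UNIV. \<bar>x $ i\<bar> / \<nu>)"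
    by (intro sum_mono theta_max_le assms)
  moreover have "- (\<mu>\<^sup>2 / (2 * \<rho>)) \<le> aug_term A b C d \<sigma> x \<mu> \<rho>"
    using assms by (simp add: aug_term_def divide_simps)
  ultimately show ?thesis by (simp add: dc_obj_def dc_f1_def dc_f2_def)
qed

lemma convex_on_linearized:
  fixes A C :: "real^'n^'m"
  assumes "pos_semidef (transpose A ** C)" "\<nu> > 0" "\<rho> > 0"
  shows "convex_on UNIV (linearized A b C d \<nu> \<sigma> \<rho> \<mu> \<delta>)"
proof -
  have "concave_on UNIV (\<lambda>y::real^'n. \<Sum>i\<in>UNIV. theta \<nu> (\<delta> i) (y $ i))"
    unfolding concave_on_def
  proof (rule convex_onI)
    fix t :: real and x y :: "real^'n"
    have "theta \<nu> k ((1 - t) * r + t * s) = (1 - t) * theta \<nu> k r + t * theta \<nu> k s" for k r s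
      by (simp add: theta_def algebra_simps add_divide_distrib diff_divide_distrib)
    then show "- (\<Sum>i\<in>UNIV. theta \<nu> (\<delta> i) (((1 - t) *\<^sub>R x + t *\<^sub>R y) $ i))
        \<le> (1 - t) * - (\<Sum>i\<in>UNIV. theta \<nu> (\<delta> i) (x $ i)) + t * - (\<Sum>i\<in>UNIV. theta \<nu> (\<delta> i) (y $ i))"
      by (simp add: sum.distrib sum_distrib_left)
  qed simp
  from convex_on_diff[OF convex_on_dc_f1[OF assms] this] show ?thesis
    by (simp add: linearized_def[abs_def])
qed

lemma continuous_on_linearized:
  fixes S :: "(real^'n) set"
  shows "continuous_on S (linearized A b C d \<nu> \<sigma> \<rho> \<mu> \<delta>)"
proof -
  have "continuous_on S (\<lambda>y. theta \<nu> (\<delta> i) (y $ i))" for i and S :: "(real^'n) set"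
    by (rule continuous_on_compose2[OF continuous_on_theta[of UNIV]]) (auto intro!: continuous_intros)
  then show ?thesis
    unfolding linearized_def[abs_def] by (intro continuous_on_diff continuous_on_sum continuous_on_dc_f1)
qed

text \<open>
  The subtracted pieces are affine with gradient \<open>l\<close>, so a subgradient \<open>- v\<close> of the majorant becomes
  the subgradient \<open>l - v\<close> of \<open>f\<^sub>1\<close>.
\<close>

lemma linearized_minimizer_lifted_stationary:
  assumes psd: "pos_semidef (transpose A ** C)" and pos: "\<nu> > 0" "\<rho> > 0"
    and x: "x \<in> feasible_set A b C d" and \<delta>: "\<And>i. \<delta> i \<in> active_set \<nu> (x $ i)"
    and min: "\<And>y. y \<in> feasible_set A b C d \<Longrightarrow>
      linearized A b C d \<nu> \<sigma> \<rho> \<mu> \<delta> x \<le> linearized A b C d \<nu> \<sigma> \<rho> \<mu> \<delta> y"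
  shows "lifted_stationary A b C d \<nu> \<sigma> \<rho> \<mu> x"
proof -
  let ?f1 = "dc_f1 A b C d \<nu> \<sigma> \<rho> \<mu>" and ?F = "feasible_set A b C d"
  define l where "l = (\<Sum>i\<in>UNIV. deriv (theta \<nu> (\<delta> i)) (x $ i) *\<^sub>R axis i (1::real))"
  have lin: "(\<Sum>i\<in>UNIV. theta \<nu> (\<delta> i) (y $ i)) = (\<Sum>i\<in>UNIV. theta \<nu> (\<delta> i) (x $ i)) + l \<bullet> (y - x)" for y
  proof -
    have "l \<bullet> (y - x) = (\<Sum>i\<in>UNIV. deriv (theta \<nu> (\<delta> i)) (x $ i) * (y $ i - x $ i))"
      by (simp add: l_def inner_sum_left inner_axis' )
    then show ?thesis by (simp add: sum.distrib[symmetric] theta_affine[symmetric])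
  qed
  obtain v where v: "v \<in> normal_cone ?F x"
      "- v \<in> subdifferential (linearized A b C d \<nu> \<sigma> \<rho> \<mu> \<delta>) x"
    using minimizer_subgradient_normal[OF convex_on_linearized[OF psd pos] feasible_set_convex x min] by blast
  have "l - v \<in> subdifferential ?f1 x"
    unfolding subdifferential_def
  proof (intro CollectI allI)
    fix y
    have "linearized A b C d \<nu> \<sigma> \<rho> \<mu> \<delta> x + - v \<bullet> (y - x) \<le> linearized A b C d \<nu> \<sigma> \<rho> \<mu> \<delta> y"
      using v(2) by (auto simp: subdifferential_def)
    then show "?f1 x + (l - v) \<bullet> (y - x) \<le> ?f1 y"
      unfolding linearized_def lin[of y] by (simp add: inner_diff_left)
  qed
  moreover have "0 = (l - v) - l + v" by simp
  ultimately show ?thesis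
    unfolding lifted_stationary_def using x \<delta> v(1) unfolding l_def by blast
qed

section \<open>The iterates\<close>

text \<open>
  Existence and uniqueness of the proximal point ensure that the definite description in the
  recursion denotes the minimizer of the subproblem.
\<close>

lemma dc_seq_step:
  fixes A C :: "real^'n^'m" and b d :: "real^'m" and \<nu> \<sigma> \<rho> \<mu> :: real and x0 :: "real^'n"
  assumes psd: "pos_semidef (transpose A ** C)" and pos: "\<nu> > 0" "\<rho> > 0"
    and ne: "feasible_set A b C d \<noteq> {}"
  defines "X \<equiv> dc_seq A b C d \<nu> \<sigma> \<rho> \<mu> x0"
  shows "X (Suc j) \<in> feasible_set A b C d"
    and "y \<in> feasible_set A b C d \<Longrightarrow>
      dc_model A b C d \<nu> \<sigma> \<rho> \<mu> (X j) (X (Suc j)) \<le> dc_model A b C d \<nu> \<sigma> \<rho> \<mu> (X j) y"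
proof -
  let ?F = "feasible_set A b C d" and ?m = "dc_model A b C d \<nu> \<sigma> \<rho> \<mu> (X j)"
  let ?g = "linearized A b C d \<nu> \<sigma> \<rho> \<mu> (\<lambda>i. dc_index \<nu> (X j $ i))"
  have g: "convex_on ?F ?g"
    by (rule convex_on_subset[OF convex_on_linearized[OF psd pos] _ feasible_set_convex]) simp
  obtain p where p: "p \<in> ?F" "\<And>z. z \<in> ?F \<Longrightarrow> ?m p \<le> ?m z"
  proof (rule prox_exists[of ?F ?g "- (\<mu>\<^sup>2 / (2 * \<rho>))" "X j"])
    show "- (\<mu>\<^sup>2 / (2 * \<rho>)) \<le> ?g y" for y
      using dc_obj_lower_bound[OF pos] dc_obj_le_linearized by (rule order_trans)
  qed (use ne in \<open>auto simp: continuous_on_linearized feasible_set_closed dc_model_eq_prox\<close>)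
  have "is_arg_min ?m (\<lambda>y. y \<in> ?F) p" using p by (auto simp: is_arg_min_linorder)
  moreover have "q = p" if "is_arg_min ?m (\<lambda>y. y \<in> ?F) q" for q
    by (rule prox_unique[OF g, where x = "X j"])
      (use p that in \<open>auto simp: is_arg_min_linorder dc_model_eq_prox\<close>)
  ultimately have "(THE y. is_arg_min ?m (\<lambda>y. y \<in> ?F) y) = p" by (rule the_equality)
  then have "X (Suc j) = p" unfolding X_def dc_seq.simps .
  then show "X (Suc j) \<in> ?F" "y \<in> ?F \<Longrightarrow> ?m (X (Suc j)) \<le> ?m y" using p by auto
qed

lemma dc_seq_feasible:
  assumes "pos_semidef (transpose A ** C)" "\<nu> > 0" "\<rho> > 0" "x0 \<in> feasible_set A b C d"
  shows "dc_seq A b C d \<nu> \<sigma> \<rho> \<mu> x0 j \<in> feasible_set A b C d"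
proof (cases j)
  case (Suc k)
  then show ?thesis using dc_seq_step(1)[OF assms(1-3)] assms(4) by blast
qed (use assms in simp)

lemma dc_seq_descent:
  fixes A C :: "real^'n^'m" and b d :: "real^'m" and \<nu> \<sigma> \<rho> \<mu> :: real and x0 :: "real^'n"
  assumes asm: "pos_semidef (transpose A ** C)" "\<nu> > 0" "\<rho> > 0" "x0 \<in> feasible_set A b C d"
  defines "X \<equiv> dc_seq A b C d \<nu> \<sigma> \<rho> \<mu> x0"
  shows "dc_obj A b C d \<nu> \<sigma> \<rho> \<mu> (X (Suc j)) + (norm (X (Suc j) - X j))\<^sup>2 / 2
    \<le> dc_obj A b C d \<nu> \<sigma> \<rho> \<mu> (X j)"
proof -
  have "dc_obj A b C d \<nu> \<sigma> \<rho> \<mu> (X (Suc j)) + (norm (X (Suc j) - X j))\<^sup>2 / 2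
      \<le> dc_model A b C d \<nu> \<sigma> \<rho> \<mu> (X j) (X (Suc j))"
    by (simp add: dc_model_eq_prox dc_obj_le_linearized)
  also have "\<dots> \<le> dc_model A b C d \<nu> \<sigma> \<rho> \<mu> (X j) (X j)"
    unfolding X_def using asm(4) dc_seq_feasible[OF asm] by (intro dc_seq_step(2) asm) auto
  also have "\<dots> = dc_obj A b C d \<nu> \<sigma> \<rho> \<mu> (X j)"
    by (simp add: dc_model_eq_prox linearized_at_base asm)
  finally show ?thesis .
qed

text \<open>
  By the descent estimate, \<open>\<parallel>x\<^sup>j\<^sup>+\<^sup>1 - x\<^sup>j\<parallel>\<^sup>2\<close> is at most twice the decrease of \<open>\<Psi>\<close>, which tends to \<open>0\<close>
  because the values of \<open>\<Psi>\<close> are decreasing and bounded below.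
\<close>

lemma dc_seq_steps_vanish:
  fixes A C :: "real^'n^'m" and b d :: "real^'m" and \<nu> \<sigma> \<rho> \<mu> :: real and x0 :: "real^'n"
  assumes asm: "pos_semidef (transpose A ** C)" "\<nu> > 0" "\<rho> > 0" "x0 \<in> feasible_set A b C d"
  defines "X \<equiv> dc_seq A b C d \<nu> \<sigma> \<rho> \<mu> x0"
  shows "(\<lambda>j. X (Suc j) - X j) \<longlonglongrightarrow> 0"
proof -
  define \<psi> where "\<psi> j = dc_obj A b C d \<nu> \<sigma> \<rho> \<mu> (X j)" for j
  have desc: "\<psi> (Suc j) + (norm (X (Suc j) - X j))\<^sup>2 / 2 \<le> \<psi> j" for j
    unfolding \<psi>_def X_def by (rule dc_seq_descent[OF asm])
  have "\<psi> (Suc j) \<le> \<psi> j" for j using desc[of j] by (smt (verit) zero_le_power2 divide_nonneg_pos)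
  then have "decseq \<psi>" by (rule decseq_SucI)
  moreover have "- (\<mu>\<^sup>2 / (2 * \<rho>)) \<le> \<psi> j" for j
    unfolding \<psi>_def by (rule dc_obj_lower_bound[OF asm(2,3)])
  ultimately obtain L where L: "\<psi> \<longlonglongrightarrow> L" using decseq_convergent by blast
  have "(\<lambda>j. 2 * (\<psi> j - \<psi> (Suc j))) \<longlonglongrightarrow> 2 * (L - L)"
    by (intro tendsto_intros L LIMSEQ_Suc[OF L])
  then have "(\<lambda>j. 2 * (\<psi> j - \<psi> (Suc j))) \<longlonglongrightarrow> 0" by simp
  then have "(\<lambda>j. (norm (X (Suc j) - X j))\<^sup>2) \<longlonglongrightarrow> 0"
  proof (rule Lim_null_comparison[rotated])
    have "(norm (X (Suc j) - X j))\<^sup>2 \<le> 2 * (\<psi> j - \<psi> (Suc j))" for j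
      using desc[of j] by (smt (verit) field_sum_of_halves)
    then show "\<forall>\<^sub>F j in sequentially. norm ((norm (X (Suc j) - X j))\<^sup>2) \<le> 2 * (\<psi> j - \<psi> (Suc j))"
      by simp
  qed
  then have "(\<lambda>j. sqrt ((norm (X (Suc j) - X j))\<^sup>2)) \<longlonglongrightarrow> sqrt 0" by (rule tendsto_real_sqrt)
  then show ?thesis by (simp add: tendsto_norm_zero_iff)
qed

lemma dc_seq_variational:
  fixes A C :: "real^'n^'m" and b d :: "real^'m" and \<nu> \<sigma> \<rho> \<mu> :: real and x0 :: "real^'n"
  assumes asm: "pos_semidef (transpose A ** C)" "\<nu> > 0" "\<rho> > 0" "x0 \<in> feasible_set A b C d"
    and y: "y \<in> feasible_set A b C d"
  defines "X \<equiv> dc_seq A b C d \<nu> \<sigma> \<rho> \<mu> x0"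
  defines "g \<equiv> \<lambda>j. linearized A b C d \<nu> \<sigma> \<rho> \<mu> (\<lambda>i. dc_index \<nu> (X j $ i))"
  shows "g j (X (Suc j)) + (X j - X (Suc j)) \<bullet> (y - X (Suc j)) \<le> g j y"
proof (rule prox_inequality)
  show "convex_on (feasible_set A b C d) (g j)" unfolding g_def
    by (rule convex_on_subset[OF convex_on_linearized[OF asm(1-3)] _ feasible_set_convex]) simp
  show "X (Suc j) \<in> feasible_set A b C d" unfolding X_def by (rule dc_seq_feasible[OF asm])
  show "g j (X (Suc j)) + (norm (X (Suc j) - X j))\<^sup>2 / 2 \<le> g j z + (norm (z - X j))\<^sup>2 / 2"
    if "z \<in> feasible_set A b C d" for z
    using dc_seq_step(2)[OF asm(1-3) _ that, of \<sigma> \<mu> x0 j] that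
    unfolding X_def[symmetric] dc_model_eq_prox g_def by blast
qed (rule y)

section \<open>Accumulation points\<close>

lemma constant_index_subsequence:
  fixes D :: "nat \<Rightarrow> 'n::finite \<Rightarrow> nat"
  assumes "\<And>j i. D j i \<in> K" "finite K"
  shows "\<exists>r \<delta>. strict_mono (r :: nat \<Rightarrow> nat) \<and> (\<forall>k. D (r k) = \<delta>)"
proof -
  have "range D \<subseteq> PiE UNIV (\<lambda>_. K)" using assms(1) by auto
  then have "finite (range D)" by (rule finite_subset) (simp add: finite_PiE assms(2))
  then obtain j0 where "infinite {j \<in> UNIV. D j = D j0}"
    using pigeonhole_infinite[of "UNIV :: nat set" D] by auto
  then obtain r :: "nat \<Rightarrow> nat" where "strict_mono r" "\<And>k. r k \<in> {j \<in> UNIV. D j = D j0}"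
    using infinite_enumerate by blast
  then show ?thesis by blast
qed

lemma active_set_limit:
  assumes "t \<longlonglongrightarrow> s" "\<And>n. k \<in> active_set \<nu> (t n)"
  shows "k \<in> active_set \<nu> s"
proof -
  have "continuous_on UNIV (theta_max \<nu>)"
    unfolding theta_max_def[abs_def] by (intro continuous_intros continuous_on_theta)
  then have "(\<lambda>n. theta_max \<nu> (t n)) \<longlonglongrightarrow> theta_max \<nu> s"
    using assms(1) by (rule continuous_on_tendsto_compose) auto
  moreover have "(\<lambda>n. theta \<nu> k (t n)) \<longlonglongrightarrow> theta \<nu> k s"
    using continuous_on_theta[of UNIV] assms(1) by (rule continuous_on_tendsto_compose) auto
  moreover have "theta \<nu> k (t n) = theta_max \<nu> (t n)" for n using assms(2) by (simp add: active_set_def)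
  ultimately have "theta \<nu> k s = theta_max \<nu> s" by (auto intro: LIMSEQ_unique)
  then show ?thesis using assms(2) by (auto simp: active_set_def)
qed

text \<open>
  Along a subsequence with constant pieces \<open>\<delta>\<close>, both \<open>x\<^sup>j\<close> and \<open>x\<^sup>j\<^sup>+\<^sup>1\<close> tend to the accumulation point,
  so the variational inequality of the steps passes to the limit.
\<close>

lemma dc_seq_accumulation_stationary:
  assumes asm: "pos_semidef (transpose A ** C)" "\<nu> > 0" "\<rho> > 0" "x0 \<in> feasible_set A b C d"
    and acc: "accumulation_point (dc_seq A b C d \<nu> \<sigma> \<rho> \<mu> x0) xbar"
  shows "lifted_stationary A b C d \<nu> \<sigma> \<rho> \<mu> xbar"
proof -
  define X where "X = dc_seq A b C d \<nu> \<sigma> \<rho> \<mu> x0"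
  let ?F = "feasible_set A b C d" and ?g = "linearized A b C d \<nu> \<sigma> \<rho> \<mu>"
  obtain r where r: "strict_mono r" "(X \<circ> r) \<longlonglongrightarrow> xbar"
    using acc unfolding accumulation_point_def X_def by auto
  obtain q :: "nat \<Rightarrow> nat" and \<delta>
    where q: "strict_mono q" "\<And>k. (\<lambda>i. dc_index \<nu> (X (r (q k)) $ i)) = \<delta>"
    using constant_index_subsequence[of "\<lambda>j i. dc_index \<nu> (X (r j) $ i)" "{1, 2, 3}", OF dc_index_range]
    by auto
  define s where "s = r \<circ> q"
  have s: "strict_mono s" unfolding s_def using r(1) q(1) by (rule strict_mono_o)
  have lim: "(\<lambda>k. X (s k)) \<longlonglongrightarrow> xbar"
    using LIMSEQ_subseq_LIMSEQ[OF r(2) q(1)] by (simp add: s_def o_def)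
  have step: "(\<lambda>k. X (Suc (s k)) - X (s k)) \<longlonglongrightarrow> 0"
    using LIMSEQ_subseq_LIMSEQ[OF dc_seq_steps_vanish[OF asm] s] by (simp add: X_def o_def)
  have lim': "(\<lambda>k. X (Suc (s k))) \<longlonglongrightarrow> xbar"
    using tendsto_add[OF step lim] by simp
  have XF: "X j \<in> ?F" for j unfolding X_def by (rule dc_seq_feasible[OF asm])
  have xF: "xbar \<in> ?F" using closed_sequentially[OF feasible_set_closed _ lim] XF by blast
  have "\<delta> i \<in> active_set \<nu> (xbar $ i)" for i
  proof (rule active_set_limit)
    show "(\<lambda>k. X (s k) $ i) \<longlonglongrightarrow> xbar $ i" using lim by (rule tendsto_vec_nth)
    show "\<delta> i \<in> active_set \<nu> (X (s k) $ i)" for k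
      using dc_index_active[OF asm(2), of "X (s k) $ i"] q(2)[of k, THEN fun_cong, of i] by (simp add: s_def)
  qed
  moreover have "?g \<delta> xbar \<le> ?g \<delta> y" if y: "y \<in> ?F" for y
  proof -
    have "?g \<delta> (X (Suc (s k))) + (X (s k) - X (Suc (s k))) \<bullet> (y - X (Suc (s k))) \<le> ?g \<delta> y" for k
      using dc_seq_variational[OF asm y, of \<sigma> \<mu> "s k", folded X_def] q(2)[of k] by (simp add: s_def)
    moreover have "(\<lambda>k. ?g \<delta> (X (Suc (s k))) + (X (s k) - X (Suc (s k))) \<bullet> (y - X (Suc (s k))))
        \<longlonglongrightarrow> ?g \<delta> xbar + (xbar - xbar) \<bullet> (y - xbar)"
      by (intro tendsto_intros lim lim' continuous_on_tendsto_compose[OF continuous_on_linearized[of UNIV]]) auto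
    ultimately have "?g \<delta> xbar + (xbar - xbar) \<bullet> (y - xbar) \<le> ?g \<delta> y"
      by (intro LIMSEQ_le_const2) auto
    then show ?thesis by simp
  qed
  ultimately show ?thesis by (rule linearized_minimizer_lifted_stationary[OF asm(1-3) xF])
qed

theorem theorem5:
  fixes A C :: "real^'n^'m" and b d :: "real^'m"
    and \<nu> \<sigma> \<rho> \<mu> :: real and x0 :: "real^'n"
  assumes "pos_semidef (transpose A ** C)"
    and "\<exists>x. A *v x - b \<ge> 0 \<and> C *v x - d \<ge> 0 \<and> (A *v x - b) \<bullet> (C *v x - d) = 0"
    and "\<nu> > 0" and "\<sigma> > 0" and "\<rho> > 0"
    and "x0 \<in> feasible_set A b C d"
    and "bounded {x \<in> feasible_set A b C d.
           dc_obj A b C d \<nu> \<sigma> \<rho> \<mu> x \<le> dc_obj A b C d \<nu> \<sigma> \<rho> \<mu> x0}"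
  shows "bounded (range (dc_seq A b C d \<nu> \<sigma> \<rho> \<mu> x0)) \<and>
         (\<forall>xbar. accumulation_point (dc_seq A b C d \<nu> \<sigma> \<rho> \<mu> x0) xbar \<longrightarrow>
                 lifted_stationary A b C d \<nu> \<sigma> \<rho> \<mu> xbar)"
proof (intro conjI allI impI)
  note asm = assms(1,3,5,6)
  let ?X = "dc_seq A b C d \<nu> \<sigma> \<rho> \<mu> x0"
  have "dc_obj A b C d \<nu> \<sigma> \<rho> \<mu> (?X j) \<le> dc_obj A b C d \<nu> \<sigma> \<rho> \<mu> x0" for j
  proof (induction j)
    case (Suc j)
    have "0 \<le> (norm (?X (Suc j) - ?X j))\<^sup>2 / 2" by simp
    then show ?case using dc_seq_descent[OF asm, of \<sigma> \<mu> j] Suc.IH by linarith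
  qed simp
  then have "range ?X \<subseteq> {x \<in> feasible_set A b C d.
      dc_obj A b C d \<nu> \<sigma> \<rho> \<mu> x \<le> dc_obj A b C d \<nu> \<sigma> \<rho> \<mu> x0}"
    using dc_seq_feasible[OF asm] by blast
  with assms(7) show "bounded (range ?X)" by (rule bounded_subset)
  show "lifted_stationary A b C d \<nu> \<sigma> \<rho> \<mu> xbar" if "accumulation_point ?X xbar" for xbar
    using asm that by (rule dc_seq_accumulation_stationary)
qed

end
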